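(* Let $\mathcal{H}$ be a separable Hilbert space, let $\{(\mathcal{W}_i,v_i)\}_{i\in I}$ be a fusion Bessel sequence in $\mathcal{H}$ with fusion frame operator $S_{\mathcal{W}}$, and let $K\in\mathcal{L}(\mathcal{H})$. Then $\{(\mathcal{W}_i,v_i)\}_{i\in I}$ is a $K$-fusion frame for $\mathcal{H}$ if and only if there exists a constant $A>0$ such that $S_{\mathcal{W}}\ge AKK^*$.
   Context: The index set $I$ is finite or countable. $\mathcal{L}(\mathcal{H})$ is the space of bounded linear operators on $\mathcal{H}$; $P_{\mathcal{W}}$ denotes the orthogonal projection onto the closed subspace $\mathcal{W}$; $S\ge T$ for self-adjoint operators means $\langle Sf,f\rangle\ge\langle Tf,f\rangle$ for all $f\in\mathcal{H}$. Let $\{\mathcal{W}_i\}_{i\in I}$ be closed subspaces of $\mathcal{H}$ and $\{v_i\}_{i\in I}$ positive weights. $\{(\mathcal{W}_i,v_i)\}_{i\in I}$ is a fusion Bessel sequence in $\mathcal{H}$ if there is $B>0$ with $\sum_{i\in I}v_i^2\|P_{\mathcal{W}_i}f\|^2\le B\|f\|^2$ for all $f\in\mathcal{H}$; its fusion frame operator is $S_{\mathcal{W}}f=\sum_{i\in I}v_i^2P_{\mathcal{W}_i}f$. It is a $K$-fusion frame for $\mathcal{H}$ if there are $A,B>0$ with $A\|K^*f\|^2\le\sum_{i\in I}v_i^2\|P_{\mathcal{W}_i}f\|^2\le B\|f\|^2$ for all $f\in\mathcal{H}$. *)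

theory Defs
  imports "HOL-Analysis.Analysis" "HOL-Library.Nonpos_Ints"
begin

text \<open>
  The axioms on \<open>kcnj\<close> force the scalar field to be the reals (with the identity) or the
  complex numbers (with complex conjugation): expanding \<open>(1 + z) * kcnj (1 + z)\<close> shows that
  \<open>z + kcnj z\<close> is real, so every scalar is a root of a real quadratic.
\<close>

class real_or_complex = real_normed_field +
  fixes kcnj :: "'a \<Rightarrow> 'a"
  assumes kcnj_add: "kcnj (x + y) = kcnj x + kcnj y"
    and kcnj_mult: "kcnj (x * y) = kcnj x * kcnj y"
    and kcnj_kcnj: "kcnj (kcnj x) = x"
    and mult_kcnj: "x * kcnj x = (norm x)\<^sup>2 *\<^sub>R 1"

instantiation real :: real_or_complex
begin
definition kcnj_real :: "real \<Rightarrow> real" where "kcnj_real x = x"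
instance
  by standard (simp_all add: kcnj_real_def power2_eq_square)
end

instantiation complex :: real_or_complex
begin
definition kcnj_complex :: "complex \<Rightarrow> complex" where "kcnj_complex = cnj"
instance
  by standard (simp_all only: kcnj_complex_def complex_cnj_add complex_cnj_mult complex_cnj_cnj
      scaleR_conv_of_real complex_norm_square[symmetric] mult_1_right)
end

text \<open>
  Hilbert spaces over the scalar field \<open>'k\<close>, with inner product linear in the first argument.
  Norm, topology and completeness are those of the type \<open>'h\<close>; positive definiteness of \<open>ip\<close> is
  contained in \<open>ip_self\<close>.
\<close>

locale hilbert_space = vector_space scl
  for scl :: "'k::real_or_complex \<Rightarrow> 'h::{real_normed_vector, complete_space} \<Rightarrow> 'h" +
  fixes ip :: "'h \<Rightarrow> 'h \<Rightarrow> 'k"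
  assumes scale_of_real: "scl (of_real r) x = r *\<^sub>R x"
    and ip_add_left: "ip (x + y) z = ip x z + ip y z"
    and ip_scale_left: "ip (scl c x) y = c * ip x y"
    and ip_commute: "ip x y = kcnj (ip y x)"
    and ip_self: "ip x x = of_real ((norm x)\<^sup>2)"

lemma hilbert_space_real:
  "hilbert_space (scaleR :: real \<Rightarrow> 'a \<Rightarrow> 'a) (inner :: 'a::{real_inner, complete_space} \<Rightarrow> 'a \<Rightarrow> real)"
  by unfold_locales
    (simp_all add: algebra_simps inner_add_left inner_commute kcnj_real_def power2_norm_eq_inner)

lemma hilbert_space_complex:
  "hilbert_space ((*) :: complex \<Rightarrow> complex \<Rightarrow> complex) (\<lambda>x y. x * cnj y)"
  by unfold_locales
    (simp_all add: algebra_simps scaleR_conv_of_real kcnj_complex_def complex_norm_square[symmetric] flip: of_real_power)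

definition bounded_operator ::
  "('k::real_or_complex \<Rightarrow> 'h::{real_normed_vector, complete_space} \<Rightarrow> 'h) \<Rightarrow> ('h \<Rightarrow> 'h) \<Rightarrow> bool"
  where "bounded_operator scl T \<longleftrightarrow>
    Vector_Spaces.linear scl scl T \<and> (\<exists>C. \<forall>x. norm (T x) \<le> C * norm x)"

definition closed_subspace ::
  "('k::real_or_complex \<Rightarrow> 'h::{real_normed_vector, complete_space} \<Rightarrow> 'h) \<Rightarrow> 'h set \<Rightarrow> bool"
  where "closed_subspace scl W \<longleftrightarrow> module.subspace scl W \<and> closed W"

definition adjoint_operator :: "('h \<Rightarrow> 'h \<Rightarrow> 'k) \<Rightarrow> ('h \<Rightarrow> 'h) \<Rightarrow> 'h \<Rightarrow> 'h"
  where "adjoint_operator ip T = (THE T'. \<forall>x y. ip (T x) y = ip x (T' y))"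

definition orth_proj :: "('h::minus \<Rightarrow> 'h \<Rightarrow> 'k::zero) \<Rightarrow> 'h set \<Rightarrow> 'h \<Rightarrow> 'h"
  where "orth_proj ip W f = (THE p. p \<in> W \<and> (\<forall>w\<in>W. ip (f - p) w = 0))"

definition self_adjoint ::
  "('k::real_or_complex \<Rightarrow> 'h::{real_normed_vector, complete_space} \<Rightarrow> 'h) \<Rightarrow>
   ('h \<Rightarrow> 'h \<Rightarrow> 'k) \<Rightarrow> ('h \<Rightarrow> 'h) \<Rightarrow> bool"
  where "self_adjoint scl ip T \<longleftrightarrow> bounded_operator scl T \<and> adjoint_operator ip T = T"

text \<open>
  \<open>S \<ge> T\<close> is only meaningful for self-adjoint operators, so self-adjointness is part of the
  relation. The scalars \<open>ip (S f) f\<close> and \<open>ip (T f) f\<close> are then real, and \<open>\<real>\<^sub>\<ge>\<^sub>0\<close> is the set of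
  nonnegative reals inside \<open>'k\<close>.
\<close>

definition operator_ge ::
  "('k::real_or_complex \<Rightarrow> 'h::{real_normed_vector, complete_space} \<Rightarrow> 'h) \<Rightarrow>
   ('h \<Rightarrow> 'h \<Rightarrow> 'k) \<Rightarrow> ('h \<Rightarrow> 'h) \<Rightarrow> ('h \<Rightarrow> 'h) \<Rightarrow> bool"
  where "operator_ge scl ip S T \<longleftrightarrow>
    self_adjoint scl ip S \<and> self_adjoint scl ip T \<and>
    (\<forall>f. ip (S f) f - ip (T f) f \<in> \<real>\<^sub>\<ge>\<^sub>0)"

text \<open>
  Since \<open>infsum\<close> is \<open>0\<close> for families that are not summable, an upper bound on a sum of
  nonnegative terms has to assert summability explicitly.
\<close>

definition fusion_bessel ::
  "('h::{real_normed_vector, complete_space} \<Rightarrow> 'h \<Rightarrow> 'k::real_or_complex) \<Rightarrow>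
   'i set \<Rightarrow> ('i \<Rightarrow> 'h set) \<Rightarrow> ('i \<Rightarrow> real) \<Rightarrow> bool"
  where "fusion_bessel ip I W v \<longleftrightarrow>
    (\<exists>B>0. \<forall>f. (\<lambda>i. (v i)\<^sup>2 * (norm (orth_proj ip (W i) f))\<^sup>2) summable_on I \<and>
      (\<Sum>\<^sub>\<infinity>i\<in>I. (v i)\<^sup>2 * (norm (orth_proj ip (W i) f))\<^sup>2) \<le> B * (norm f)\<^sup>2)"

definition fusion_frame_operator ::
  "('h::{real_normed_vector, complete_space} \<Rightarrow> 'h \<Rightarrow> 'k::real_or_complex) \<Rightarrow>
   'i set \<Rightarrow> ('i \<Rightarrow> 'h set) \<Rightarrow> ('i \<Rightarrow> real) \<Rightarrow> 'h \<Rightarrow> 'h"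
  where "fusion_frame_operator ip I W v f =
    (\<Sum>\<^sub>\<infinity>i\<in>I. (v i)\<^sup>2 *\<^sub>R orth_proj ip (W i) f)"

definition K_fusion_frame ::
  "('h::{real_normed_vector, complete_space} \<Rightarrow> 'h \<Rightarrow> 'k::real_or_complex) \<Rightarrow> ('h \<Rightarrow> 'h) \<Rightarrow>
   'i set \<Rightarrow> ('i \<Rightarrow> 'h set) \<Rightarrow> ('i \<Rightarrow> real) \<Rightarrow> bool"
  where "K_fusion_frame ip K I W v \<longleftrightarrow>
    (\<exists>A>0. \<exists>B>0. \<forall>f. (\<lambda>i. (v i)\<^sup>2 * (norm (orth_proj ip (W i) f))\<^sup>2) summable_on I \<and>
      A * (norm (adjoint_operator ip K f))\<^sup>2 \<le> (\<Sum>\<^sub>\<infinity>i\<in>I. (v i)\<^sup>2 * (norm (orth_proj ip (W i) f))\<^sup>2) \<and>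
      (\<Sum>\<^sub>\<infinity>i\<in>I. (v i)\<^sup>2 * (norm (orth_proj ip (W i) f))\<^sup>2) \<le> B * (norm f)\<^sup>2)"

end

(* Bessel's condition and Cauchy-Schwarz give
   |sum_{i in F} v_i^2 P_i f|^2 <= B * sum_{i in F} v_i^2 |P_i f|^2 for finite F, so the series of
   S f converges unconditionally and S is bounded and self-adjoint with
   <S f, f> = sum_i v_i^2 |P_i f|^2. As <K K* f, f> = |K* f|^2, the lower K-fusion frame inequality
   says exactly that S - A K K* >= 0. The projections and K* exist by the nearest point theorem
   and the Riesz representation theorem. *)

theory Submission
  imports Defs
begin

section \<open>Conjugation on the scalar field\<close>

lemma kcnj_zero [simp]: "kcnj 0 = (0 :: 'k::real_or_complex)"
  using kcnj_add[of "0::'k" 0] by simp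

lemma kcnj_of_real [simp]: "kcnj (of_real r) = (of_real r :: 'k::real_or_complex)"
proof (cases "r = 0")
  case False
  have "of_real r * kcnj (of_real r) = (of_real r * of_real r :: 'k)"
    by (simp add: mult_kcnj scaleR_conv_of_real power2_eq_square)
  with False show ?thesis by simp
qed simp

lemma mult_kcnj_of_real: "z * kcnj z = of_real ((norm z)\<^sup>2)"
  by (simp add: mult_kcnj scaleR_conv_of_real)

text \<open>As conjugation is an involution, z and \<open>kcnj z\<close> have the same product with
  their conjugates, and this product is the squared norm.\<close>

lemma norm_kcnj [simp]: "norm (kcnj z) = norm z"
proof -
  have "kcnj z * kcnj (kcnj z) = z * kcnj z"
    by (simp add: kcnj_kcnj mult.commute)
  then have "(norm (kcnj z))\<^sup>2 = (norm z)\<^sup>2"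
    unfolding mult_kcnj_of_real of_real_eq_iff .
  then show ?thesis by simp
qed

section \<open>Unconditional convergence from domination of finite partial sums\<close>

lemma summable_on_if_partial_sums_dominated:
  fixes g :: "'i \<Rightarrow> 'a::{real_normed_vector, complete_space}" and w :: "'i \<Rightarrow> real"
  assumes w: "w summable_on A" and w_nonneg: "\<And>i. i \<in> A \<Longrightarrow> 0 \<le> w i" and "B > 0"
    and bound: "\<And>F. finite F \<Longrightarrow> F \<subseteq> A \<Longrightarrow> (norm (sum g F))\<^sup>2 \<le> B * sum w F"
  shows "g summable_on A"
proof -
  \<comment> \<open>Cauchy criterion for the net of finite partial sums: beyond a suitable finite
    F0, the remaining mass of w is small, and the domination carries this over to g.\<close>
  have "\<exists>P. eventually P (finite_subsets_at_top A) \<and>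
      (\<forall>F F'. P F \<and> P F' \<longrightarrow> dist (sum g F) (sum g F') < e)" if "e > 0" for e
  proof -
    \<comment> \<open>Chosen so that B * d = (e/3)^2. Two partial sums beyond F0 then differ by at
      most 2e/3, strictly less than e.\<close>
    define d where "d = (e / 3)\<^sup>2 / B"
    have "d > 0" using that \<open>B > 0\<close> by (simp add: d_def)
    then obtain F0 where F0: "finite F0" "F0 \<subseteq> A" "dist (sum w F0) (infsum w A) \<le> d"
      using infsum_finite_approximation[OF w] by blast
    define P where "P F \<longleftrightarrow> finite F \<and> F0 \<subseteq> F \<and> F \<subseteq> A" for F
    have near: "dist (sum g F) (sum g F0) \<le> e / 3" if "P F" for F
    proof -
      have F: "finite F" "F0 \<subseteq> F" "F \<subseteq> A" using that by (auto simp: P_def)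
      have "sum w F \<le> infsum w A"
        by (rule finite_sum_le_infsum) (use F w w_nonneg in auto)
      then have "sum w F - sum w F0 \<le> d"
        using F0 by (simp add: dist_real_def)
      then have "sum w (F - F0) \<le> d"
        using F F0 by (simp add: sum_diff)
      have "(norm (sum g (F - F0)))\<^sup>2 \<le> B * sum w (F - F0)"
        by (rule bound) (use F in auto)
      also have "\<dots> \<le> B * d"
        using \<open>sum w (F - F0) \<le> d\<close> \<open>B > 0\<close> by simp
      also have "\<dots> = (e / 3)\<^sup>2"
        using \<open>B > 0\<close> by (simp add: d_def)
      finally have "norm (sum g (F - F0)) \<le> e / 3"
        using \<open>e > 0\<close> by (simp add: power2_le_iff_abs_le)
      then show ?thesis
        using F F0 by (simp add: dist_norm sum_diff)
    qed
    have "dist (sum g F) (sum g F') < e" if "P F" "P F'" for F F'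
      using dist_triangle2[of "sum g F" "sum g F'" "sum g F0"] near[OF that(1)] near[OF that(2)] \<open>e > 0\<close>
      by linarith
    moreover have "eventually P (finite_subsets_at_top A)"
      unfolding eventually_finite_subsets_at_top P_def using F0 by blast
    ultimately show ?thesis by blast
  qed
  then have "cauchy_filter (filtermap (sum g) (finite_subsets_at_top A))"
    by (simp add: cauchy_filter_metric_filtermap)
  moreover have "complete (UNIV::'a set)"
    by (meson Cauchy_convergent UNIV_I complete_def convergent_def)
  ultimately obtain L where "(sum g \<longlongrightarrow> L) (finite_subsets_at_top A)"
    using complete_uniform[where S=UNIV] by (force simp add: filterlim_def)
  then show ?thesis
    using summable_on_def has_sum_def by blast
qed

section \<open>Linearity and norm bounds of bounded operators\<close>

lemma bounded_operator_add: "bounded_operator scl T \<Longrightarrow> T (x + y) = T x + T y"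
  by (simp add: bounded_operator_def Vector_Spaces.linear_iff)

lemma bounded_operator_scale: "bounded_operator scl T \<Longrightarrow> T (scl c x) = scl c (T x)"
  by (simp add: bounded_operator_def Vector_Spaces.linear_iff)

lemma bounded_operator_bound:
  assumes "bounded_operator scl T"
  obtains C where "C \<ge> 0" "\<And>x. norm (T x) \<le> C * norm x"
proof -
  obtain C where C: "\<And>x. norm (T x) \<le> C * norm x"
    using assms by (auto simp: bounded_operator_def)
  \<comment> \<open>The constant in \<open>bounded_operator\<close> may be negative when the space
    is zero; \<open>max C 0\<close> bounds T in every case.\<close>
  have "norm (T x) \<le> max C 0 * norm x" for x
    by (rule order_trans[OF C]) (simp add: mult_right_mono)
  then show thesis by (intro that[of "max C 0"]) auto
qed

context hilbert_space
begin

subsection \<open>Inner product and norm\<close>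

lemma ip_add_right: "ip x (y + z) = ip x y + ip x z"
  by (metis ip_add_left ip_commute kcnj_add)

lemma ip_scale_right: "ip x (scl c y) = kcnj c * ip x y"
  by (metis ip_scale_left ip_commute kcnj_mult)

lemma ip_zero_left [simp]: "ip 0 y = 0"
  using ip_add_left[of 0 0 y] by simp

lemma ip_zero_right [simp]: "ip y 0 = 0"
  using ip_add_right[of y 0 0] by simp

lemma ip_diff_left: "ip (x - y) z = ip x z - ip y z"
  using ip_add_left[of "x - y" y z] by (simp add: algebra_simps)

lemma ip_diff_right: "ip z (x - y) = ip z x - ip z y"
  using ip_add_right[of z "x - y" y] by (simp add: algebra_simps)

lemma ip_scaleR_left: "ip (r *\<^sub>R x) y = of_real r * ip x y"
  by (simp add: ip_scale_left flip: scale_of_real)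

lemma ip_scaleR_right: "ip x (r *\<^sub>R y) = of_real r * ip x y"
  by (simp add: ip_scale_right flip: scale_of_real)

lemma scl_scaleR: "scl c (r *\<^sub>R x) = r *\<^sub>R scl c x"
  by (simp add: mult.commute flip: scale_of_real)

text \<open>The norm of the type is homogeneous for real scalars only; for scalars in
  \<open>'k\<close> this comes from the inner product, since c * \<open>kcnj c\<close> is the
  squared norm of c.\<close>

lemma norm_scl: "norm (scl c x) = norm c * norm x"
proof -
  have "of_real ((norm (scl c x))\<^sup>2) = (c * kcnj c) * (of_real ((norm x)\<^sup>2) :: 'k)"
    unfolding ip_self[symmetric] by (simp add: ip_scale_left ip_scale_right mult.assoc)
  also have "\<dots> = of_real ((norm c * norm x)\<^sup>2)"
    by (simp add: mult_kcnj_of_real power_mult_distrib)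
  finally show ?thesis
    unfolding of_real_eq_iff by (simp add: power2_eq_iff_nonneg)
qed

lemma bounded_linear_scl: "bounded_linear (scl c)"
  by (rule bounded_linear_intro[where K = "norm c"])
    (simp_all add: scale_right_distrib scl_scaleR norm_scl mult.commute)

lemma norm_ip_self: "norm (ip x x) = (norm x)\<^sup>2"
  by (simp add: ip_self norm_power)

lemma ip_eqI:
  assumes "\<And>x. ip x y = ip x z"
  shows "y = z"
proof -
  have "ip (y - z) (y - z) = 0"
    using assms[of "y - z"] by (simp add: ip_diff_right)
  then show ?thesis by (simp add: ip_self)
qed

lemma parallelogram:
  fixes x y :: 'h
  shows "(norm (x + y))\<^sup>2 + (norm (x - y))\<^sup>2 = 2 * (norm x)\<^sup>2 + 2 * (norm y)\<^sup>2"
proof -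
  have "ip (x + y) (x + y) + ip (x - y) (x - y) = 2 * ip x x + 2 * ip y y"
    by (simp add: ip_add_left ip_add_right ip_diff_left ip_diff_right algebra_simps)
  then have "(of_real ((norm (x + y))\<^sup>2 + (norm (x - y))\<^sup>2) :: 'k)
      = of_real (2 * (norm x)\<^sup>2 + 2 * (norm y)\<^sup>2)"
    by (simp only: ip_self of_real_add of_real_mult of_real_numeral)
  then show ?thesis unfolding of_real_eq_iff .
qed

text \<open>Division by \<open>0\<close> yields \<open>0\<close>, so \<open>w = 0\<close> is no exception here.\<close>

lemma norm_diff_component:
  "(norm (x - scl (of_real (1 / (norm w)\<^sup>2) * ip x w) w))\<^sup>2 = (norm x)\<^sup>2 - (norm (ip x w))\<^sup>2 / (norm w)\<^sup>2"
proof -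
  define r where "r = 1 / (norm w)\<^sup>2"
  define a where "a = ip x w"
  \<comment> \<open>The coefficient of the projection of x onto the line through w, so the claim is
    Pythagoras for x - c w and c w.\<close>
  define c where "c = of_real r * a"
  have a': "ip w x = kcnj a"
    using ip_commute[of w x] by (simp add: a_def)
  have c': "kcnj c = of_real r * kcnj a"
    by (simp add: c_def kcnj_mult)
  have r: "r * r * (norm w)\<^sup>2 = r"
    by (cases "w = 0") (simp_all add: r_def power2_eq_square)
  have "of_real ((norm (x - scl c w))\<^sup>2)
      = ip x x - kcnj c * a - c * kcnj a + c * kcnj c * ip w w"
    unfolding ip_self[symmetric] a'[symmetric]
    by (simp add: a_def ip_diff_left ip_diff_right ip_scale_left ip_scale_right algebra_simps)
  also have "\<dots> = of_real ((norm x)\<^sup>2) - 2 * (of_real r * (a * kcnj a))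
      + of_real (r * r * (norm w)\<^sup>2) * (a * kcnj a)"
    unfolding c' ip_self of_real_mult by (simp add: c_def algebra_simps)
  also have "\<dots> = of_real ((norm x)\<^sup>2 - r * (norm a)\<^sup>2)"
    unfolding r mult_kcnj_of_real by simp
  finally show ?thesis
    unfolding of_real_eq_iff by (simp add: c_def r_def a_def)
qed

text \<open>The right-hand side of \<open>norm_diff_component\<close> equals a square and is
  therefore nonnegative.\<close>

lemma ip_Cauchy_Schwarz: "norm (ip x y) \<le> norm x * norm y"
proof (cases "y = 0")
  case False
  have "(norm (ip x y))\<^sup>2 / (norm y)\<^sup>2 \<le> (norm x)\<^sup>2"
    using norm_diff_component[of x y] zero_le_power2 by (metis diff_ge_0_iff_ge)
  with False have "(norm (ip x y))\<^sup>2 \<le> (norm x * norm y)\<^sup>2"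
    by (simp add: divide_le_eq power_mult_distrib)
  then show ?thesis
    by (rule power2_le_imp_le) simp
qed simp

lemma bounded_linear_ip_left: "bounded_linear (\<lambda>x. ip x y)"
  by (rule bounded_linear_intro[where K = "norm y"])
    (simp_all add: ip_add_left ip_scaleR_left scaleR_conv_of_real ip_Cauchy_Schwarz)

lemma bounded_linear_ip_right: "bounded_linear (\<lambda>x. ip y x)"
  by (rule bounded_linear_intro[where K = "norm y"])
    (use ip_Cauchy_Schwarz[of y] in \<open>simp_all add: ip_add_right ip_scaleR_right scaleR_conv_of_real mult.commute\<close>)

subsection \<open>Orthogonal projections\<close>

text \<open>A minimizing sequence is Cauchy by the parallelogram law, because midpoints of its
  members stay in W; completeness and closedness of W give the minimizer.\<close>

lemma closest_point_exists:
  assumes W: "closed_subspace scl W"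
  obtains p where "p \<in> W" "\<And>w. w \<in> W \<Longrightarrow> norm (f - p) \<le> norm (f - w)"
proof -
  have sub: "subspace W" and cl: "closed W"
    using W by (auto simp: closed_subspace_def)
  have "W \<noteq> {}" using subspace_0[OF sub] by auto
  define d where "d = infdist f W"
  have d: "d \<le> norm (f - w)" if "w \<in> W" for w
    using infdist_le[OF that, of f] by (simp add: d_def dist_norm)
  have "d \<ge> 0" by (simp add: d_def infdist_nonneg)
  \<comment> \<open>The error is measured on the squared distance, which is what the parallelogram
    law uses. If no such w existed, sqrt (d^2 + 1/(n+1)) would be a lower bound for the distances
    exceeding their infimum d.\<close>
  have "\<exists>w\<in>W. (norm (f - w))\<^sup>2 < d\<^sup>2 + 1 / Suc n" for n
  proof (rule ccontr)
    assume "\<not> ?thesis"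
    then have "sqrt (d\<^sup>2 + 1 / Suc n) \<le> dist f w" if "w \<in> W" for w
      using that unfolding dist_norm by (intro real_le_lsqrt) (auto simp: not_less)
    then have "sqrt (d\<^sup>2 + 1 / Suc n) \<le> d"
      unfolding d_def infdist_notempty[OF \<open>W \<noteq> {}\<close>] using \<open>W \<noteq> {}\<close> by (intro cINF_greatest) auto
    then have "d\<^sup>2 + 1 / Suc n \<le> d\<^sup>2"
      by (rule sqrt_le_D)
    then show False by simp
  qed
  then obtain u where u: "\<And>n. u n \<in> W" "\<And>n. (norm (f - u n))\<^sup>2 < d\<^sup>2 + 1 / Suc n"
    by metis
  \<comment> \<open>The midpoint has distance at least d from f, so |(f - u_m) + (f - u_n)|^2 >= 4
    d^2. The parallelogram law leaves at most 2/(m+1) + 2/(n+1), which is at most 4/(N+1).\<close>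
  have close: "(norm (u m - u n))\<^sup>2 \<le> 4 / Suc N" if "m \<ge> N" "n \<ge> N" for m n N
  proof -
    have mid: "(1/2) *\<^sub>R (u m + u n) \<in> W"
      unfolding scale_of_real[symmetric] by (intro subspace_scale subspace_add sub u)
    have "(f - u m) + (f - u n) = 2 *\<^sub>R (f - (1/2) *\<^sub>R (u m + u n))"
      by (simp add: algebra_simps scaleR_2)
    then have "norm ((f - u m) + (f - u n)) = 2 * norm (f - (1/2) *\<^sub>R (u m + u n))"
      by simp
    then have "2 * d \<le> norm ((f - u m) + (f - u n))"
      using d[OF mid] by simp
    then have "(2 * d)\<^sup>2 \<le> (norm ((f - u m) + (f - u n)))\<^sup>2"
      using \<open>d \<ge> 0\<close> by (intro power_mono) auto
    moreover have "norm ((f - u m) - (f - u n)) = norm (u m - u n)"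
      by (simp add: norm_minus_commute)
    moreover have "1 / Suc m \<le> 1 / Suc N" "1 / Suc n \<le> 1 / Suc N"
      using that by (simp_all add: field_simps)
    ultimately show ?thesis
      using parallelogram[of "f - u m" "f - u n"] u(2)[of m] u(2)[of n]
      by (simp add: power_mult_distrib)
  qed
  have "Cauchy u"
  proof (rule metric_CauchyI)
    fix e :: real assume "e > 0"
    then obtain N where N: "inverse (real (Suc N)) < e\<^sup>2 / 4"
      using reals_Archimedean[of "e\<^sup>2 / 4"] by auto
    have "dist (u m) (u n) < e" if "m \<ge> N" "n \<ge> N" for m n
    proof -
      have "(norm (u m - u n))\<^sup>2 < e\<^sup>2"
        using close[OF that] N divide_inverse[of 4 "real (Suc N)"] by linarith
      then show ?thesis
        using \<open>e > 0\<close> by (simp add: dist_norm power_less_imp_less_base)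
    qed
    then show "\<exists>M. \<forall>m\<ge>M. \<forall>n\<ge>M. dist (u m) (u n) < e" by blast
  qed
  then obtain p where p: "u \<longlonglongrightarrow> p"
    using Cauchy_convergent convergent_def by blast
  have "p \<in> W"
    using closed_sequentially[OF cl _ p] u(1) by blast
  have "(\<lambda>n. (norm (f - u n))\<^sup>2) \<longlonglongrightarrow> (norm (f - p))\<^sup>2"
    by (intro tendsto_intros p)
  moreover have "(\<lambda>n. d\<^sup>2 + 1 / Suc n) \<longlonglongrightarrow> d\<^sup>2 + 0"
    by (intro tendsto_intros LIMSEQ_Suc[OF lim_1_over_n])
  ultimately have "(norm (f - p))\<^sup>2 \<le> d\<^sup>2 + 0"
    using u(2) by (intro LIMSEQ_le[of _ _ "\<lambda>n. d\<^sup>2 + 1 / Suc n"]) (auto intro: less_imp_le)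
  then have "norm (f - p) \<le> d"
    using \<open>d \<ge> 0\<close> by (simp only: add_0_right) (rule power2_le_imp_le)
  with d \<open>p \<in> W\<close> show thesis by (intro that[of p]) (auto intro: order_trans)
qed

text \<open>Two candidates p and q differ by an element of W that is also a difference of residuals,
  hence orthogonal to itself. This resolves the description in \<open>orth_proj\<close>.\<close>

lemma orth_proj_eqI:
  assumes W: "closed_subspace scl W" and p: "p \<in> W" "\<And>w. w \<in> W \<Longrightarrow> ip (f - p) w = 0"
  shows "orth_proj ip W f = p"
  unfolding orth_proj_def
proof (rule the_equality)
  fix q assume q: "q \<in> W \<and> (\<forall>w\<in>W. ip (f - q) w = 0)"
  have "p - q \<in> W"
    using W p q by (auto simp: closed_subspace_def intro: subspace_diff)
  then have "ip (f - q) (p - q) - ip (f - p) (p - q) = 0"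
    using p q by simp
  then have "ip (p - q) (p - q) = 0"
    by (simp add: flip: ip_diff_left)
  then show "q = p" by (simp add: ip_self)
qed (use p in auto)

text \<open>The nearest point qualifies: if its residual had a nonzero component along some w in W,
  moving by that component would bring the point closer to f.\<close>

lemma
  assumes W: "closed_subspace scl W"
  shows orth_proj_in: "orth_proj ip W f \<in> W"
    and orth_proj_orthogonal: "w \<in> W \<Longrightarrow> ip (f - orth_proj ip W f) w = 0"
proof -
  obtain p where p: "p \<in> W" "\<And>w. w \<in> W \<Longrightarrow> norm (f - p) \<le> norm (f - w)"
    using closest_point_exists[OF W] by blast
  have orth: "ip (f - p) w = 0" if "w \<in> W" for w
  proof (cases "w = 0")
    case False
    let ?c = "of_real (1 / (norm w)\<^sup>2) * ip (f - p) w"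
    have "p + scl ?c w \<in> W"
      using W that p by (auto simp: closed_subspace_def intro: subspace_add subspace_scale)
    then have "norm (f - p) \<le> norm (f - (p + scl ?c w))"
      by (rule p)
    then have "(norm (f - p))\<^sup>2 \<le> (norm (f - p - scl ?c w))\<^sup>2"
      by (intro power_mono) (simp_all add: algebra_simps)
    then have "(norm (ip (f - p) w))\<^sup>2 / (norm w)\<^sup>2 \<le> 0"
      unfolding norm_diff_component by simp
    with False show ?thesis
      by (simp add: divide_le_0_iff)
  qed simp
  have "orth_proj ip W f = p"
    by (rule orth_proj_eqI[OF W p(1) orth])
  with p orth show "orth_proj ip W f \<in> W" "w \<in> W \<Longrightarrow> ip (f - orth_proj ip W f) w = 0"
    by auto
qed

lemma orth_proj_add:
  assumes W: "closed_subspace scl W"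
  shows "orth_proj ip W (f + g) = orth_proj ip W f + orth_proj ip W g"
proof (rule orth_proj_eqI[OF W])
  show "orth_proj ip W f + orth_proj ip W g \<in> W"
    using W orth_proj_in[OF W] by (auto simp: closed_subspace_def intro: subspace_add)
  fix w assume "w \<in> W"
  then have "ip (f - orth_proj ip W f) w + ip (g - orth_proj ip W g) w = 0"
    by (simp add: orth_proj_orthogonal[OF W])
  then show "ip (f + g - (orth_proj ip W f + orth_proj ip W g)) w = 0"
    by (simp add: algebra_simps flip: ip_add_left)
qed

lemma orth_proj_scale:
  assumes W: "closed_subspace scl W"
  shows "orth_proj ip W (scl c f) = scl c (orth_proj ip W f)"
proof (rule orth_proj_eqI[OF W])
  show "scl c (orth_proj ip W f) \<in> W"
    using W orth_proj_in[OF W] by (auto simp: closed_subspace_def intro: subspace_scale)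
  fix w assume "w \<in> W"
  then show "ip (scl c f - scl c (orth_proj ip W f)) w = 0"
    by (simp add: orth_proj_orthogonal[OF W] ip_scale_left flip: scale_right_diff_distrib)
qed

text \<open>The residual of f is orthogonal to the projection of g, which lies in W.\<close>

lemma ip_orth_proj_orth_proj:
  assumes W: "closed_subspace scl W"
  shows "ip (orth_proj ip W f) (orth_proj ip W g) = ip f (orth_proj ip W g)"
  using orth_proj_orthogonal[OF W orth_proj_in[OF W], of f g] by (simp add: ip_diff_left)

lemma orth_proj_selfadjoint:
  assumes W: "closed_subspace scl W"
  shows "ip (orth_proj ip W f) g = ip f (orth_proj ip W g)"
  by (metis W ip_orth_proj_orth_proj ip_commute)

lemma ip_orth_proj_self:
  assumes W: "closed_subspace scl W"
  shows "ip (orth_proj ip W f) f = of_real ((norm (orth_proj ip W f))\<^sup>2)"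
  by (metis W ip_orth_proj_orth_proj orth_proj_selfadjoint ip_self)

subsection \<open>Riesz representation and adjoints\<close>

text \<open>Unless the functional vanishes, its kernel N is a proper closed subspace. The residual e
  of a vector outside N is orthogonal to N, and a multiple of e represents the functional.\<close>

lemma riesz_representation:
  fixes \<phi> :: "'h \<Rightarrow> 'k"
  assumes add: "\<And>x y. \<phi> (x + y) = \<phi> x + \<phi> y" and scale: "\<And>c x. \<phi> (scl c x) = c * \<phi> x"
    and bound: "\<And>x. norm (\<phi> x) \<le> C * norm x"
  obtains y where "\<And>x. \<phi> x = ip x y"
proof (cases "\<forall>x. \<phi> x = 0")
  case True
  then show ?thesis using that[of 0] by simp
next
  case False
  then obtain x0 where x0: "\<phi> x0 \<noteq> 0" by blast
  define N where "N = {x. \<phi> x = 0}"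
  have zero: "\<phi> 0 = 0" using scale[of 0 0] by simp
  have diff: "\<phi> (x - y) = \<phi> x - \<phi> y" for x y
    using add[of "x - y" y] by (simp add: algebra_simps)
  have "bounded_linear \<phi>"
    by (rule bounded_linear_intro[where K = C])
      (use scale[of "of_real _"] bound in
        \<open>simp_all add: add scale_of_real scaleR_conv_of_real mult.commute\<close>)
  then have "closed N"
    unfolding N_def by (intro closed_Collect_eq linear_continuous_on continuous_on_const)
  moreover have "subspace N"
    by (rule subspaceI) (auto simp: N_def zero add scale)
  ultimately have N: "closed_subspace scl N" by (simp add: closed_subspace_def)
  define e where "e = x0 - orth_proj ip N x0"
  have "\<phi> (orth_proj ip N x0) = 0"
    using orth_proj_in[OF N] by (simp add: N_def)
  then have e: "\<phi> e \<noteq> 0" using x0 by (simp add: e_def diff)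
  then have "e \<noteq> 0" using zero by auto
  have orth: "ip x e = 0" if "x \<in> N" for x
    using orth_proj_orthogonal[OF N that, of x0] ip_commute[of x e] by (simp add: e_def)
  \<comment> \<open>Subtracting the right multiple of e moves x into N, which computes <x, e>. The
    coefficient is conjugated because \<open>ip\<close> is conjugate-linear in its second
    argument.\<close>
  have "\<phi> x = ip x (scl (kcnj (\<phi> e / ip e e)) e)" for x
  proof -
    have "x - scl (\<phi> x / \<phi> e) e \<in> N"
      using e by (simp add: N_def diff scale)
    then have "ip x e = \<phi> x / \<phi> e * ip e e"
      using orth by (force simp: ip_diff_left ip_scale_left)
    moreover have "ip e e \<noteq> 0" using \<open>e \<noteq> 0\<close> by (simp add: ip_self)
    ultimately show ?thesis using e by (simp add: ip_scale_right kcnj_kcnj)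
  qed
  then show ?thesis by (rule that)
qed

lemma adjoint_operator_eqI:
  assumes "\<And>x y. ip (T x) y = ip x (T' y)"
  shows "adjoint_operator ip T = T'"
  unfolding adjoint_operator_def
proof (rule the_equality)
  fix T'' assume "\<forall>x y. ip (T x) y = ip x (T'' y)"
  with assms show "T'' = T'" by (intro ext ip_eqI) metis
qed (use assms in auto)

text \<open>For fixed y, the functional x -> <T x, y> is bounded and Riesz supplies its representing
  vector. Choosing one for each y gives a map that \<open>adjoint_operator_eqI\<close> identifies
  with the described adjoint.\<close>

lemma adjoint_operator:
  assumes T: "bounded_operator scl T"
  shows "ip (T x) y = ip x (adjoint_operator ip T y)"
proof -
  obtain C where C: "C \<ge> 0" "\<And>x. norm (T x) \<le> C * norm x"
    using bounded_operator_bound[OF T] by blast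
  have "\<exists>z. \<forall>x. ip (T x) y = ip x z" for y
  proof -
    have "norm (ip (T x) y) \<le> (C * norm y) * norm x" for x
    proof -
      have "norm (ip (T x) y) \<le> norm (T x) * norm y" by (rule ip_Cauchy_Schwarz)
      also have "\<dots> \<le> (C * norm x) * norm y" by (intro mult_right_mono C) simp
      finally show ?thesis by (simp add: mult_ac)
    qed
    then obtain z where "\<And>x. ip (T x) y = ip x z"
      using riesz_representation[of "\<lambda>x. ip (T x) y" "C * norm y"]
      by (auto simp: bounded_operator_add[OF T] bounded_operator_scale[OF T] ip_add_left ip_scale_left)
    then show ?thesis by blast
  qed
  then obtain T' where "\<And>x y. ip (T x) y = ip x (T' y)" by metis
  then show ?thesis using adjoint_operator_eqI by metis
qed

lemma adjoint_operator_right: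
  assumes "bounded_operator scl T"
  shows "ip x (T y) = ip (adjoint_operator ip T x) y"
  by (metis adjoint_operator[OF assms] ip_commute)

lemma bounded_operatorI:
  assumes "\<And>x y. T (x + y) = T x + T y" "\<And>c x. T (scl c x) = scl c (T x)"
    "\<And>x. norm (T x) \<le> C * norm x"
  shows "bounded_operator scl T"
  unfolding bounded_operator_def Vector_Spaces.linear_iff
  using assms vector_space_axioms by blast

lemma bounded_operator_adjoint:
  assumes T: "bounded_operator scl T"
  shows "bounded_operator scl (adjoint_operator ip T)"
proof -
  note adj = adjoint_operator[OF T, symmetric]
  obtain C where C: "C \<ge> 0" "\<And>x. norm (T x) \<le> C * norm x"
    using bounded_operator_bound[OF T] by blast
  show ?thesis
  proof (rule bounded_operatorI)
    fix y
    let ?z = "adjoint_operator ip T y"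
    \<comment> \<open>With z = T* y, |z|^2 = <T z, y> <= C |z| |y|. It remains to cancel |z|; the
      case z = 0 rests on C >= 0.\<close>
    have "(norm ?z)\<^sup>2 = norm (ip ?z ?z)"
      by (rule norm_ip_self[symmetric])
    also have "\<dots> = norm (ip (T ?z) y)"
      by (simp add: adj)
    also have "\<dots> \<le> norm (T ?z) * norm y"
      by (rule ip_Cauchy_Schwarz)
    also have "\<dots> \<le> C * norm ?z * norm y"
      by (intro mult_right_mono C) simp
    finally have "norm ?z * norm ?z \<le> norm ?z * (C * norm y)"
      by (simp add: power2_eq_square mult_ac)
    then show "norm ?z \<le> C * norm y"
      using C by (cases "norm ?z = 0") (auto simp: mult_le_cancel_left)
  qed (auto intro!: ip_eqI simp: adj ip_add_right ip_scale_right)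
qed

lemma self_adjointI:
  assumes "bounded_operator scl T" "\<And>x y. ip (T x) y = ip x (T y)"
  shows "self_adjoint scl ip T"
  using assms by (simp add: self_adjoint_def adjoint_operator_eqI)

text \<open>\<open>operator_ge\<close> demands self-adjointness of both operators. Here both <K K*
  x, y> and <x, K K* y> equal <K* x, K* y>.\<close>

lemma self_adjoint_scaleR_mult_adjoint:
  assumes K: "bounded_operator scl K"
  shows "self_adjoint scl ip (\<lambda>f. A *\<^sub>R K (adjoint_operator ip K f))"
proof (rule self_adjointI)
  let ?K' = "adjoint_operator ip K"
  have K': "bounded_operator scl ?K'" by (rule bounded_operator_adjoint[OF K])
  obtain C where C: "C \<ge> 0" "\<And>x. norm (K x) \<le> C * norm x"
    using bounded_operator_bound[OF K] by blast
  obtain D where D: "D \<ge> 0" "\<And>x. norm (?K' x) \<le> D * norm x"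
    using bounded_operator_bound[OF K'] by blast
  show "bounded_operator scl (\<lambda>f. A *\<^sub>R K (?K' f))"
  proof (rule bounded_operatorI)
    fix x
    have "norm (K (?K' x)) \<le> C * (D * norm x)"
      using C D by (meson mult_left_mono order_trans)
    then have "\<bar>A\<bar> * norm (K (?K' x)) \<le> \<bar>A\<bar> * (C * (D * norm x))"
      by (intro mult_left_mono) auto
    then show "norm (A *\<^sub>R K (?K' x)) \<le> (\<bar>A\<bar> * C * D) * norm x"
      by (simp add: mult_ac)
  qed (simp_all add: bounded_operator_add[OF K] bounded_operator_add[OF K']
      bounded_operator_scale[OF K] bounded_operator_scale[OF K'] scaleR_right_distrib scl_scaleR)
  show "ip (A *\<^sub>R K (?K' x)) y = ip x (A *\<^sub>R K (?K' y))" for x y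
    by (simp add: ip_scaleR_left ip_scaleR_right adjoint_operator[OF K] adjoint_operator_right[OF K])
qed

lemma ip_mult_adjoint_self:
  assumes K: "bounded_operator scl K"
  shows "ip (K (adjoint_operator ip K f)) f = of_real ((norm (adjoint_operator ip K f))\<^sup>2)"
  by (simp add: adjoint_operator[OF K] ip_self)

subsection \<open>The fusion frame operator\<close>

text \<open>Write g for the sum and S(h) for the weighted sum of |P_i h|^2. Then |g|^2 is the sum of
  v_i^2 <P_i f, P_i g>, so Cauchy-Schwarz gives |g|^4 <= S(f) S(g) <= S(f) B |g|^2, and |g|^2
  cancels.\<close>

lemma norm_sum_orth_proj_le:
  assumes W: "\<And>i. i \<in> F \<Longrightarrow> closed_subspace scl (W i)" and "B \<ge> 0"
    and B: "\<And>f. (\<Sum>i\<in>F. (v i)\<^sup>2 * (norm (orth_proj ip (W i) f))\<^sup>2) \<le> B * (norm f)\<^sup>2"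
  shows "(norm (\<Sum>i\<in>F. (v i)\<^sup>2 *\<^sub>R orth_proj ip (W i) f))\<^sup>2
    \<le> B * (\<Sum>i\<in>F. (v i)\<^sup>2 * (norm (orth_proj ip (W i) f))\<^sup>2)"
proof -
  let ?g = "\<Sum>i\<in>F. (v i)\<^sup>2 *\<^sub>R orth_proj ip (W i) f"
  \<comment> \<open>The weight v_i^2 is split evenly between the two factors, so that the squares of
    \<open>?a h\<close> add up to \<open>?S h\<close>.\<close>
  let ?a = "\<lambda>f i. \<bar>v i\<bar> * norm (orth_proj ip (W i) f)"
  let ?S = "\<lambda>f. \<Sum>i\<in>F. (v i)\<^sup>2 * (norm (orth_proj ip (W i) f))\<^sup>2"
  have a2: "(\<Sum>i\<in>F. (?a h i)\<^sup>2) = ?S h" for h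
    by (simp add: power_mult_distrib)
  have "ip ?g ?g = (\<Sum>i\<in>F. ip ((v i)\<^sup>2 *\<^sub>R orth_proj ip (W i) f) ?g)"
    by (rule linear_sum[OF bounded_linear.linear[OF bounded_linear_ip_left]])
  also have "\<dots> = (\<Sum>i\<in>F. of_real ((v i)\<^sup>2) * ip (orth_proj ip (W i) f) (orth_proj ip (W i) ?g))"
  proof (intro sum.cong refl)
    fix i assume "i \<in> F"
    \<comment> \<open>Self-adjointness moves P_i onto g and idempotence restores it on f, which
      makes S(g) appear.\<close>
    then have "ip (orth_proj ip (W i) f) ?g = ip (orth_proj ip (W i) f) (orth_proj ip (W i) ?g)"
      by (intro trans[OF orth_proj_selfadjoint ip_orth_proj_orth_proj[symmetric]] W)
    then show "ip ((v i)\<^sup>2 *\<^sub>R orth_proj ip (W i) f) ?g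
        = of_real ((v i)\<^sup>2) * ip (orth_proj ip (W i) f) (orth_proj ip (W i) ?g)"
      by (simp only: ip_scaleR_left)
  qed
  finally have "norm (ip ?g ?g) = norm (\<Sum>i\<in>F. of_real ((v i)\<^sup>2) * ip (orth_proj ip (W i) f) (orth_proj ip (W i) ?g))"
    by (rule arg_cong)
  also have "\<dots> \<le> (\<Sum>i\<in>F. ?a f i * ?a ?g i)"
  proof (rule sum_norm_le)
    fix i
    have "(v i)\<^sup>2 * norm (ip (orth_proj ip (W i) f) (orth_proj ip (W i) ?g))
        \<le> (v i)\<^sup>2 * (norm (orth_proj ip (W i) f) * norm (orth_proj ip (W i) ?g))"
      by (intro mult_left_mono ip_Cauchy_Schwarz) simp
    then show "norm (of_real ((v i)\<^sup>2) * ip (orth_proj ip (W i) f) (orth_proj ip (W i) ?g)) \<le> ?a f i * ?a ?g i"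
      by (simp add: norm_mult norm_power power2_eq_square mult_ac)
  qed
  finally have "(norm ?g)\<^sup>2 \<le> (\<Sum>i\<in>F. ?a f i * ?a ?g i)"
    unfolding norm_ip_self .
  then have "((norm ?g)\<^sup>2)\<^sup>2 \<le> (\<Sum>i\<in>F. ?a f i * ?a ?g i)\<^sup>2"
    by (rule power_mono) simp
  also have "\<dots> \<le> ?S f * ?S ?g"
    using Cauchy_Schwarz_ineq_sum[of "?a f" "?a ?g" F] unfolding a2 .
  also have "\<dots> \<le> ?S f * (B * (norm ?g)\<^sup>2)"
    by (intro mult_left_mono B sum_nonneg) simp
  finally have le: "(norm ?g)\<^sup>2 * (norm ?g)\<^sup>2 \<le> (norm ?g)\<^sup>2 * (B * ?S f)"
    by (simp only: power2_eq_square[of "(norm ?g)\<^sup>2"] mult_ac)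
  show ?thesis
  proof (cases "?g = 0")
    case True
    then show ?thesis using \<open>B \<ge> 0\<close> by (simp add: sum_nonneg)
  next
    case False
    then have "(norm ?g)\<^sup>2 > 0" by simp
    with le show ?thesis by (rule mult_left_le_imp_le)
  qed
qed

context
  fixes I :: "'i set" and W :: "'i \<Rightarrow> 'h set" and v :: "'i \<Rightarrow> real"
  assumes closed_subspace_W: "\<And>i. i \<in> I \<Longrightarrow> closed_subspace scl (W i)"
    and bessel: "fusion_bessel ip I W v"
begin

lemma fusion_bessel_summable:
  "(\<lambda>i. (v i)\<^sup>2 * (norm (orth_proj ip (W i) f))\<^sup>2) summable_on I"
  using bessel by (auto simp: fusion_bessel_def)

text \<open>A Bessel bound for the series also bounds every finite partial sum, since the terms are
  nonnegative; thus \<open>norm_sum_orth_proj_le\<close> applies with the same B.\<close>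

lemma fusion_bessel_bound:
  obtains B where "B > 0"
    "\<And>f. (\<Sum>\<^sub>\<infinity>i\<in>I. (v i)\<^sup>2 * (norm (orth_proj ip (W i) f))\<^sup>2) \<le> B * (norm f)\<^sup>2"
    "\<And>F f. finite F \<Longrightarrow> F \<subseteq> I \<Longrightarrow>
      (norm (\<Sum>i\<in>F. (v i)\<^sup>2 *\<^sub>R orth_proj ip (W i) f))\<^sup>2
        \<le> B * (\<Sum>i\<in>F. (v i)\<^sup>2 * (norm (orth_proj ip (W i) f))\<^sup>2)"
proof -
  obtain B where B: "B > 0"
    "\<And>f. (\<Sum>\<^sub>\<infinity>i\<in>I. (v i)\<^sup>2 * (norm (orth_proj ip (W i) f))\<^sup>2) \<le> B * (norm f)\<^sup>2"
    using bessel by (auto simp: fusion_bessel_def)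
  show thesis
  proof (rule that[OF B])
    fix F f assume F: "finite F" "F \<subseteq> I"
    show "(norm (\<Sum>i\<in>F. (v i)\<^sup>2 *\<^sub>R orth_proj ip (W i) f))\<^sup>2
        \<le> B * (\<Sum>i\<in>F. (v i)\<^sup>2 * (norm (orth_proj ip (W i) f))\<^sup>2)"
    proof (rule norm_sum_orth_proj_le)
      fix h
      have "(\<Sum>i\<in>F. (v i)\<^sup>2 * (norm (orth_proj ip (W i) h))\<^sup>2)
          \<le> (\<Sum>\<^sub>\<infinity>i\<in>I. (v i)\<^sup>2 * (norm (orth_proj ip (W i) h))\<^sup>2)"
        by (rule finite_sum_le_infsum) (use F fusion_bessel_summable in auto)
      with B(2)[of h] show "(\<Sum>i\<in>F. (v i)\<^sup>2 * (norm (orth_proj ip (W i) h))\<^sup>2) \<le> B * (norm h)\<^sup>2"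
        by linarith
    qed (use F B closed_subspace_W in auto)
  qed
qed

text \<open>\<open>infsum\<close> defaults to 0 on families that are not summable; this rules that
  case out, so the operator is the genuine limit of its partial sums.\<close>

lemma has_sum_fusion_frame_operator:
  "((\<lambda>i. (v i)\<^sup>2 *\<^sub>R orth_proj ip (W i) f) has_sum fusion_frame_operator ip I W v f) I"
proof -
  obtain B where "B > 0"
    "\<And>F. finite F \<Longrightarrow> F \<subseteq> I \<Longrightarrow> (norm (\<Sum>i\<in>F. (v i)\<^sup>2 *\<^sub>R orth_proj ip (W i) f))\<^sup>2
        \<le> B * (\<Sum>i\<in>F. (v i)\<^sup>2 * (norm (orth_proj ip (W i) f))\<^sup>2)"
    by (rule fusion_bessel_bound) blast
  then have "(\<lambda>i. (v i)\<^sup>2 *\<^sub>R orth_proj ip (W i) f) summable_on I"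
    by (intro summable_on_if_partial_sums_dominated[OF fusion_bessel_summable]) auto
  then show ?thesis
    unfolding fusion_frame_operator_def by (rule has_sum_infsum)
qed

text \<open>The inner product is continuous and passes through the series, where each <P_i f, f> is
  |P_i f|^2.\<close>

lemma ip_fusion_frame_operator_self:
  "ip (fusion_frame_operator ip I W v f) f
    = of_real (\<Sum>\<^sub>\<infinity>i\<in>I. (v i)\<^sup>2 * (norm (orth_proj ip (W i) f))\<^sup>2)"
proof (rule has_sum_unique)
  show "((\<lambda>i. ip ((v i)\<^sup>2 *\<^sub>R orth_proj ip (W i) f) f)
      has_sum ip (fusion_frame_operator ip I W v f) f) I"
    by (rule has_sum_bounded_linear[OF bounded_linear_ip_left has_sum_fusion_frame_operator])
  have "((\<lambda>i. of_real ((v i)\<^sup>2 * (norm (orth_proj ip (W i) f))\<^sup>2)) has_sum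
      (of_real (\<Sum>\<^sub>\<infinity>i\<in>I. (v i)\<^sup>2 * (norm (orth_proj ip (W i) f))\<^sup>2) :: 'k)) I"
    by (intro has_sum_of_real has_sum_infsum fusion_bessel_summable)
  then show "((\<lambda>i. ip ((v i)\<^sup>2 *\<^sub>R orth_proj ip (W i) f) f) has_sum
      of_real (\<Sum>\<^sub>\<infinity>i\<in>I. (v i)\<^sup>2 * (norm (orth_proj ip (W i) f))\<^sup>2)) I"
    by (rule has_sum_cong[THEN iffD1, rotated])
      (simp add: ip_scaleR_left ip_orth_proj_self[OF closed_subspace_W])
qed

lemma self_adjoint_fusion_frame_operator:
  "self_adjoint scl ip (fusion_frame_operator ip I W v)"
proof (rule self_adjointI)
  let ?S = "fusion_frame_operator ip I W v"
  note S = has_sum_fusion_frame_operator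
  obtain B where B: "B > 0"
    "\<And>f. (\<Sum>\<^sub>\<infinity>i\<in>I. (v i)\<^sup>2 * (norm (orth_proj ip (W i) f))\<^sup>2) \<le> B * (norm f)\<^sup>2"
    "\<And>F f. finite F \<Longrightarrow> F \<subseteq> I \<Longrightarrow> (norm (\<Sum>i\<in>F. (v i)\<^sup>2 *\<^sub>R orth_proj ip (W i) f))\<^sup>2
        \<le> B * (\<Sum>i\<in>F. (v i)\<^sup>2 * (norm (orth_proj ip (W i) f))\<^sup>2)"
    by (rule fusion_bessel_bound) blast
  show "bounded_operator scl ?S"
  proof (rule bounded_operatorI)
    fix x y
    have "((\<lambda>i. (v i)\<^sup>2 *\<^sub>R orth_proj ip (W i) (x + y)) has_sum ?S x + ?S y) I"
      by (rule has_sum_cong[THEN iffD1, rotated, OF has_sum_add[OF S S]])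
        (simp add: orth_proj_add[OF closed_subspace_W] scaleR_right_distrib)
    then show "?S (x + y) = ?S x + ?S y"
      by (rule has_sum_unique[OF S])
  next
    fix c x
    have "((\<lambda>i. (v i)\<^sup>2 *\<^sub>R orth_proj ip (W i) (scl c x)) has_sum scl c (?S x)) I"
      by (rule has_sum_cong[THEN iffD1, rotated, OF has_sum_bounded_linear[OF bounded_linear_scl S]])
        (simp add: orth_proj_scale[OF closed_subspace_W] scl_scaleR)
    then show "?S (scl c x) = scl c (?S x)"
      by (rule has_sum_unique[OF S])
  next
    fix f
    \<comment> \<open>B enters twice, once from the partial sum estimate and once from Bessel, so
      the squared norm is at most B^2 |f|^2. The bound is uniform in F and survives the
      limit.\<close>
    have "norm (\<Sum>i\<in>F. (v i)\<^sup>2 *\<^sub>R orth_proj ip (W i) f) \<le> B * norm f" if "finite F" "F \<subseteq> I" for F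
    proof (rule power2_le_imp_le)
      have "(\<Sum>i\<in>F. (v i)\<^sup>2 * (norm (orth_proj ip (W i) f))\<^sup>2)
          \<le> (\<Sum>\<^sub>\<infinity>i\<in>I. (v i)\<^sup>2 * (norm (orth_proj ip (W i) f))\<^sup>2)"
        by (rule finite_sum_le_infsum) (use that fusion_bessel_summable in auto)
      then have "B * (\<Sum>i\<in>F. (v i)\<^sup>2 * (norm (orth_proj ip (W i) f))\<^sup>2) \<le> B * (B * (norm f)\<^sup>2)"
        using B(1) B(2)[of f] by (intro mult_left_mono) auto
      with B(3)[OF that, of f]
      show "(norm (\<Sum>i\<in>F. (v i)\<^sup>2 *\<^sub>R orth_proj ip (W i) f))\<^sup>2 \<le> (B * norm f)\<^sup>2"
        by (simp add: power_mult_distrib power2_eq_square mult_ac)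
    qed (use B in simp)
    then have "\<forall>\<^sub>F F in finite_subsets_at_top I.
        norm (\<Sum>i\<in>F. (v i)\<^sup>2 *\<^sub>R orth_proj ip (W i) f) \<le> B * norm f"
      by (intro eventually_finite_subsets_at_top_weakI)
    then show "norm (?S f) \<le> B * norm f"
      using S[of f] unfolding has_sum_def
      by (intro tendsto_upperbound[OF tendsto_norm]) auto
  qed
  show "ip (?S x) y = ip x (?S y)" for x y
  proof (rule has_sum_unique)
    show "((\<lambda>i. ip ((v i)\<^sup>2 *\<^sub>R orth_proj ip (W i) x) y) has_sum ip (?S x) y) I"
      by (rule has_sum_bounded_linear[OF bounded_linear_ip_left S])
    show "((\<lambda>i. ip ((v i)\<^sup>2 *\<^sub>R orth_proj ip (W i) x) y) has_sum ip x (?S y)) I"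
      by (rule has_sum_cong[THEN iffD1, rotated, OF has_sum_bounded_linear[OF bounded_linear_ip_right S]])
        (simp add: ip_scaleR_left ip_scaleR_right orth_proj_selfadjoint[OF closed_subspace_W])
  qed
qed

text \<open>Both operators are self-adjoint, and the difference of their quadratic forms is the
  image of a real number, so only the sign of that number is at stake.\<close>

lemma operator_ge_fusion_frame_operator_iff:
  assumes K: "bounded_operator scl K"
  shows "operator_ge scl ip (fusion_frame_operator ip I W v) (\<lambda>f. A *\<^sub>R K (adjoint_operator ip K f))
    \<longleftrightarrow> (\<forall>f. A * (norm (adjoint_operator ip K f))\<^sup>2
          \<le> (\<Sum>\<^sub>\<infinity>i\<in>I. (v i)\<^sup>2 * (norm (orth_proj ip (W i) f))\<^sup>2))"
proof -
  have "ip (fusion_frame_operator ip I W v f) f - ip (A *\<^sub>R K (adjoint_operator ip K f)) f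
      = of_real ((\<Sum>\<^sub>\<infinity>i\<in>I. (v i)\<^sup>2 * (norm (orth_proj ip (W i) f))\<^sup>2)
          - A * (norm (adjoint_operator ip K f))\<^sup>2)" for f
    by (simp add: ip_fusion_frame_operator_self ip_scaleR_left ip_mult_adjoint_self[OF K])
  then show ?thesis
    unfolding operator_ge_def
    by (simp only: self_adjoint_fusion_frame_operator self_adjoint_scaleR_mult_adjoint[OF K]
        nonneg_Reals_of_real_iff diff_ge_0_iff_ge simp_thms)
qed

text \<open>Summability and the upper bound are exactly the Bessel property, leaving the lower
  inequality.\<close>

lemma K_fusion_frame_iff:
  "K_fusion_frame ip K I W v \<longleftrightarrow>
    (\<exists>A>0. \<forall>f. A * (norm (adjoint_operator ip K f))\<^sup>2
      \<le> (\<Sum>\<^sub>\<infinity>i\<in>I. (v i)\<^sup>2 * (norm (orth_proj ip (W i) f))\<^sup>2))"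
  using bessel unfolding K_fusion_frame_def fusion_bessel_def by blast

end

end

theorem theorem4p4:
  fixes scl :: "'k::real_or_complex \<Rightarrow> 'h::{real_normed_vector, complete_space} \<Rightarrow> 'h"
    and ip :: "'h \<Rightarrow> 'h \<Rightarrow> 'k"
    and I :: "'i set"
    and W :: "'i \<Rightarrow> 'h set"
    and v :: "'i \<Rightarrow> real"
    and K :: "'h \<Rightarrow> 'h"
  assumes "hilbert_space scl ip"
    and "separable_space (euclidean :: 'h topology)"
    and "countable I"
    and "\<And>i. i \<in> I \<Longrightarrow> closed_subspace scl (W i)"
    and "\<And>i. i \<in> I \<Longrightarrow> v i > 0"
    and "fusion_bessel ip I W v"
    and "bounded_operator scl K"
  shows "K_fusion_frame ip K I W v \<longleftrightarrow>
    (\<exists>A>0. operator_ge scl ip (fusion_frame_operator ip I W v)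
      (\<lambda>f. A *\<^sub>R K (adjoint_operator ip K f)))"
proof -
  interpret hilbert_space scl ip by fact
  \<comment> \<open>Both sides reduce to the same lower inequality, with the same constant
    A.\<close>
  show ?thesis
    using assms(4,6,7) by (simp add: K_fusion_frame_iff operator_ge_fusion_frame_operator_iff)
qed

end
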